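(* Suppose that $\widetilde G=K_n$ (i.e. $\tilde g_{ij}=1$ for all $i\neq j$). If the complement of $G$ is connected, then for all sufficiently high $\beta$ the optimal public signal $\varphi^*$ informs the agents only of the average state; that is, $\varphi^*$ is informationally equivalent to disclosing only $\bar x=\frac1n\sum_{i=1}^n x_i$.
   Context: Model. There are one principal and $n$ agents. Agent $i$ chooses $a_i\in\mathbb R$; $\mathbf a=(a_1,\dots,a_n)'$. The state $\mathbf x=(x_1,\dots,x_n)'$ is distributed as $N(\mu\mathbf 1_n,\sigma^2 I_n)$, with $\mu\in\mathbb R$, $\sigma^2>0$, $\mathbf 1_n$ the vector of ones. The incentive graph $G=[g_{ij}]$ and the synergy graph $\widetilde G=[\tilde g_{ij}]$ are symmetric $n\times n$ matrices with entries in $\{0,1\}$ and zero diagonal; $\beta\ge0$ is a parameter. The complement of $G$ is the graph on the same vertices in which distinct $i,j$ are adjacent iff $g_{ij}=0$. Agent $i$'s payoff is $u_i(\mathbf a,\mathbf x)=-(a_i-x_i)^2-\beta\sum_{j} g_{ij}(a_i-a_j)^2$; the principal's payoff is $v(\mathbf a,\mathbf x)=-\sum_i (a_i-x_i)^2-\beta\sum_i\sum_j\tilde g_{ij}(a_i-a_j)^2$. A public signal is a map (Markov kernel) $\varphi:\mathbb R^n\to\Delta(M)$, $M$ a measurable space. All agents observe the realization $m$ and nothing else, form $\hat{\mathbf x}=\mathbb E[\mathbf x\mid m]$, and play the unique Nash equilibrium $\mathbf a^*=B\hat{\mathbf x}$, $B=(I_n+\beta L)^{-1}$, where $L=D_G-G$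 and $\widetilde L=D_{\widetilde G}-\widetilde G$ are the graph Laplacians ($D$ the diagonal degree matrix). Then $\mathbb E[v(\mathbf a^*,\mathbf x)]=-\mathbb E[\mathbf x'\mathbf x]+\mathbb E[\hat{\mathbf x}'V\hat{\mathbf x}]$ with $V=B'(I_n-2\beta(\widetilde L-L))B$. A signal is optimal if it maximizes $\mathbb E[v(\mathbf a^*,\mathbf x)]$ (equivalently $\mathbb E[\hat{\mathbf x}'V\hat{\mathbf x}]$) over all public signals. By a known theorem, if $\mathbf z_1,\dots,\mathbf z_n$ is an orthonormal eigenbasis of the symmetric matrix $V$ with eigenvalues $\omega_1,\dots,\omega_n$, then the signal disclosing exactly the statistics $\mathbf z_j'\mathbf x$ for all $j$ with $\omega_j\ge0$ is optimal; "the optimal public signal" $\varphi^*$ denotes this signal. *)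

theory Defs
  imports "HOL-Probability.Probability"
begin

text \<open>Agents are the elements of the finite type 'n; graphs are their adjacency matrices.\<close>

definition is_graph :: "real ^ 'n ^ 'n \<Rightarrow> bool" where
  "is_graph G \<longleftrightarrow> transpose G = G \<and> (\<forall>i j. G $ i $ j \<in> {0, 1}) \<and> (\<forall>i. G $ i $ i = 0)"

definition complete_graph :: "real ^ 'n ^ 'n" where
  "complete_graph = (\<chi> i j. if i = j then 0 else 1)"

definition complement_graph :: "real ^ 'n ^ 'n \<Rightarrow> real ^ 'n ^ 'n" where
  "complement_graph G = (\<chi> i j. if i \<noteq> j \<and> G $ i $ j = 0 then 1 else 0)"

definition graph_connected :: "real ^ 'n ^ 'n \<Rightarrow> bool" where
  "graph_connected G \<longleftrightarrow> (\<forall>i j. (i, j) \<in> {(k, l). G $ k $ l = 1}\<^sup>*)"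

definition degree_matrix :: "real ^ 'n ^ 'n \<Rightarrow> real ^ 'n ^ 'n" where
  "degree_matrix G = (\<chi> i j. if i = j then \<Sum>k\<in>UNIV. G $ i $ k else 0)"

definition laplacian :: "real ^ 'n ^ 'n \<Rightarrow> real ^ 'n ^ 'n" where
  "laplacian G = degree_matrix G - G"

text \<open>If the agents' common posterior mean of the state is y, the unique Nash equilibrium of the
  game with payoffs -(a_i - x_i)^2 - \<beta> (\<Sum>j. g_ij (a_i - a_j)^2) is
  \<open>equilibrium_matrix \<beta> G *v y\<close>. The inverse exists for \<beta> \<ge> 0.\<close>

definition equilibrium_matrix :: "real \<Rightarrow> real ^ 'n ^ 'n \<Rightarrow> real ^ 'n ^ 'n" where
  "equilibrium_matrix \<beta> G = matrix_inv (mat 1 + \<beta> *\<^sub>R laplacian G)"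

definition V_matrix :: "real \<Rightarrow> real ^ 'n ^ 'n \<Rightarrow> real ^ 'n ^ 'n \<Rightarrow> real ^ 'n ^ 'n" where
  "V_matrix \<beta> G Gt =
     transpose (equilibrium_matrix \<beta> G)
       ** (mat 1 - (2 * \<beta>) *\<^sub>R (laplacian Gt - laplacian G))
       ** equilibrium_matrix \<beta> G"

definition principal_payoff ::
    "real \<Rightarrow> real ^ 'n ^ 'n \<Rightarrow> real ^ 'n \<Rightarrow> real ^ 'n \<Rightarrow> real" where
  "principal_payoff \<beta> Gt a x =
     - (\<Sum>i\<in>UNIV. (a $ i - x $ i)\<^sup>2)
     - \<beta> * (\<Sum>i\<in>UNIV. \<Sum>j\<in>UNIV. Gt $ i $ j * (a $ i - a $ j)\<^sup>2)"

text \<open>The normal distribution with mean \<mu> in every coordinate and covariance matrix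
  \<sigma>^2 times the identity, i.e. with independent coordinates; as in \<^const>\<open>normal_density\<close>,
  \<sigma> is the standard deviation.\<close>

definition state_dist :: "real \<Rightarrow> real \<Rightarrow> (real ^ 'n) measure" where
  "state_dist \<mu> \<sigma> = density lborel (\<lambda>x. ennreal (\<Prod>i\<in>UNIV. normal_density \<mu> \<sigma> (x $ i)))"

definition public_signal :: "'m measure \<Rightarrow> (real ^ 'n \<Rightarrow> 'm measure) \<Rightarrow> bool" where
  "public_signal M K \<longleftrightarrow> K \<in> borel \<rightarrow>\<^sub>M prob_algebra M"

definition joint_dist ::
    "real \<Rightarrow> real \<Rightarrow> 'm measure \<Rightarrow> (real ^ 'n \<Rightarrow> 'm measure) \<Rightarrow> ((real ^ 'n) \<times> 'm) measure" where
  "joint_dist \<mu> \<sigma> M K =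
     state_dist \<mu> \<sigma> \<bind> (\<lambda>x. K x \<bind> (\<lambda>m. return (borel \<Otimes>\<^sub>M M) (x, m)))"

text \<open>The conditional expectation of the state given the message, as a random vector on the space
  of state-message pairs; it is measurable with respect to the message alone.\<close>

definition posterior_mean ::
    "real \<Rightarrow> real \<Rightarrow> 'm measure \<Rightarrow> (real ^ 'n \<Rightarrow> 'm measure) \<Rightarrow> (real ^ 'n) \<times> 'm \<Rightarrow> real ^ 'n" where
  "posterior_mean \<mu> \<sigma> M K w =
     (let J = joint_dist \<mu> \<sigma> M K
      in \<chi> i. real_cond_exp J (vimage_algebra (space J) snd M) (\<lambda>p. fst p $ i) w)"

definition expected_payoff ::
    "real \<Rightarrow> real \<Rightarrow> real \<Rightarrow> real ^ 'n ^ 'n \<Rightarrow> real ^ 'n ^ 'n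
      \<Rightarrow> 'm measure \<Rightarrow> (real ^ 'n \<Rightarrow> 'm measure) \<Rightarrow> real" where
  "expected_payoff \<mu> \<sigma> \<beta> G Gt M K =
     (\<integral>w. principal_payoff \<beta> Gt (equilibrium_matrix \<beta> G *v posterior_mean \<mu> \<sigma> M K w) (fst w)
        \<partial>joint_dist \<mu> \<sigma> M K)"

text \<open>HOL cannot quantify over types inside a formula, so the message type 'k of the competing
  signals is a parameter, to be left arbitrary.\<close>

definition optimal_signal ::
    "'k itself \<Rightarrow> real \<Rightarrow> real \<Rightarrow> real \<Rightarrow> real ^ 'n ^ 'n \<Rightarrow> real ^ 'n ^ 'n
      \<Rightarrow> 'm measure \<Rightarrow> (real ^ 'n \<Rightarrow> 'm measure) \<Rightarrow> bool" where
  "optimal_signal _ \<mu> \<sigma> \<beta> G Gt M K \<longleftrightarrow>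
     public_signal M K \<and>
     (\<forall>(M' :: 'k measure) K'. public_signal M' K' \<longrightarrow>
        expected_payoff \<mu> \<sigma> \<beta> G Gt M' K' \<le> expected_payoff \<mu> \<sigma> \<beta> G Gt M K)"

definition disclosure :: "'m measure \<Rightarrow> (real ^ 'n \<Rightarrow> 'm) \<Rightarrow> real ^ 'n \<Rightarrow> 'm measure" where
  "disclosure M f = (\<lambda>x. return M (f x))"

definition orthonormal_eigenbasis ::
    "real ^ 'n ^ 'n \<Rightarrow> ('n \<Rightarrow> real ^ 'n) \<Rightarrow> ('n \<Rightarrow> real) \<Rightarrow> bool" where
  "orthonormal_eigenbasis A z \<omega> \<longleftrightarrow>
     (\<forall>i j. z i \<bullet> z j = (if i = j then 1 else 0)) \<and> (\<forall>j. A *v z j = \<omega> j *\<^sub>R z j)"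

text \<open>The signal disclosing exactly the statistics \<open>z j \<bullet> x\<close> with \<open>\<omega> j \<ge> 0\<close>: a message is a tuple
  of reals indexed by these j.\<close>

definition phi_star_space :: "('n \<Rightarrow> real) \<Rightarrow> ('n \<Rightarrow> real) measure" where
  "phi_star_space \<omega> = (\<Pi>\<^sub>M j\<in>{j. \<omega> j \<ge> 0}. borel)"

definition phi_star ::
    "('n \<Rightarrow> real ^ 'n) \<Rightarrow> ('n \<Rightarrow> real) \<Rightarrow> real ^ 'n \<Rightarrow> ('n \<Rightarrow> real) measure" where
  "phi_star z \<omega> = disclosure (phi_star_space \<omega>) (\<lambda>x. \<lambda>j\<in>{j. \<omega> j \<ge> 0}. z j \<bullet> x)"

definition average :: "real ^ 'n \<Rightarrow> real" where
  "average x = (\<Sum>i\<in>UNIV. x $ i) / real CARD('n)"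

text \<open>Informational equivalence in the sense of Blackwell: each signal can be generated from the
  message of the other, without further access to the state. For disclosures of statistics f and g
  this says that f and g generate the same sigma-algebra.\<close>

definition garbling ::
    "'m measure \<Rightarrow> (real ^ 'n \<Rightarrow> 'm measure) \<Rightarrow> 'k measure \<Rightarrow> (real ^ 'n \<Rightarrow> 'k measure) \<Rightarrow> bool" where
  "garbling M K M' K' \<longleftrightarrow>
     (\<exists>\<kappa> \<in> M \<rightarrow>\<^sub>M prob_algebra M'. \<forall>x. K' x = K x \<bind> \<kappa>)"

definition informationally_equivalent ::
    "'m measure \<Rightarrow> (real ^ 'n \<Rightarrow> 'm measure) \<Rightarrow> 'k measure \<Rightarrow> (real ^ 'n \<Rightarrow> 'k measure) \<Rightarrow> bool" where
  "informationally_equivalent M K M' K' \<longleftrightarrow> garbling M K M' K' \<and> garbling M' K' M K"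

end

theory Submission imports Defs begin

text \<open>
  With posterior mean \<open>y\<close> the agents play \<open>a = B y\<close>, and the expected payoff is a constant plus the
  sum over \<open>j\<close> of \<open>\<omega> j\<close> times the second moment of \<open>z j \<bullet> y\<close>. By Jensen's inequality this
  moment lies between the squared mean and the second moment of \<open>z j \<bullet> x\<close>, whatever the signal.
  Disclosing the \<open>z j \<bullet> x\<close> with \<open>\<omega> j \<ge> 0\<close> attains the upper bound for these \<open>j\<close>, and the lower
  bound for the others because orthogonal coordinates of an isotropic Gaussian are independent.

  When the synergy graph is complete, the difference of the two Laplacians is the Laplacian of the
  complement of \<open>G\<close>, which is coercive on the vectors orthogonal to the vector of ones if the
  complement is connected.
  Hence for large \<open>\<beta>\<close> the matrix \<open>V\<close> is negative definite there, while it fixes the vector of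
  ones, so that the latter spans the only eigendirection with a nonnegative eigenvalue.
\<close>

subsection \<open>Laplacians and the principal's quadratic form\<close>

lemma inner_mult_eq_transpose_mult:
  fixes A :: "real ^ 'n ^ 'm"
  shows "x \<bullet> (A *v y) = (transpose A *v x) \<bullet> y"
  by (simp add: dot_lmul_matrix)

lemma transpose_laplacian: "transpose G = G \<Longrightarrow> transpose (laplacian G) = laplacian G"
  unfolding laplacian_def degree_matrix_def transpose_def vec_eq_iff
  by (auto simp: eq_commute)

lemma laplacian_mult_component:
  "(laplacian G *v y) $ i = (\<Sum>j\<in>UNIV. G $ i $ j * (y $ i - y $ j))"
proof -
  have "(laplacian G *v y) $ i =
      (\<Sum>j\<in>UNIV. (if i = j then (\<Sum>k\<in>UNIV. G $ i $ k) * y $ j else 0) - G $ i $ j * y $ j)"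
    unfolding laplacian_def degree_matrix_def matrix_vector_mult_def
    by (simp add: left_diff_distrib if_distrib[where f="\<lambda>t. t * _"] cong: if_cong)
  also have "\<dots> = (\<Sum>j\<in>UNIV. G $ i $ j * (y $ i - y $ j))"
    by (simp add: sum_subtractf sum.delta sum_distrib_right right_diff_distrib)
  finally show ?thesis .
qed

text \<open>Swapping the summation indices gives a second expression for the quadratic form, and
  adding both completes the squares. The factor 2, from counting each edge in both orders, is the
  one in \<open>V_matrix\<close>.\<close>

lemma inner_laplacian:
  assumes "transpose G = G"
  shows "(\<Sum>i\<in>UNIV. \<Sum>j\<in>UNIV. G $ i $ j * (y $ i - y $ j)\<^sup>2) = 2 * (y \<bullet> (laplacian G *v y))"
proof -
  have sym: "G $ i $ j = G $ j $ i" for i j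
    using assms by (metis transpose_def vec_lambda_beta)
  have *: "y \<bullet> (laplacian G *v y) = (\<Sum>i\<in>UNIV. \<Sum>j\<in>UNIV. y $ i * (G $ i $ j * (y $ i - y $ j)))"
    by (simp add: inner_vec_def laplacian_mult_component sum_distrib_left)
  also have "\<dots> = (\<Sum>i\<in>UNIV. \<Sum>j\<in>UNIV. y $ j * (G $ i $ j * (y $ j - y $ i)))"
    by (subst sum.swap) (simp add: sym)
  finally have **: "y \<bullet> (laplacian G *v y) = \<dots>" .
  have "2 * (y \<bullet> (laplacian G *v y)) = (\<Sum>i\<in>UNIV. \<Sum>j\<in>UNIV. y $ i * (G $ i $ j * (y $ i - y $ j)))
     + (\<Sum>i\<in>UNIV. \<Sum>j\<in>UNIV. y $ j * (G $ i $ j * (y $ j - y $ i)))"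
    using * ** by simp
  also have "\<dots> = (\<Sum>i\<in>UNIV. \<Sum>j\<in>UNIV. G $ i $ j * (y $ i - y $ j)\<^sup>2)"
    unfolding sum.distrib[symmetric] by (intro sum.cong refl) (simp add: power2_eq_square algebra_simps)
  finally show ?thesis by simp
qed

lemma inner_laplacian_nonneg:
  assumes "is_graph G"
  shows "0 \<le> y \<bullet> (laplacian G *v y)"
proof -
  have "0 \<le> G $ i $ j" for i j
    using assms unfolding is_graph_def by (metis insertE empty_iff order_refl zero_le_one)
  then have "0 \<le> (\<Sum>i\<in>UNIV. \<Sum>j\<in>UNIV. G $ i $ j * (y $ i - y $ j)\<^sup>2)"
    by (intro sum_nonneg mult_nonneg_nonneg) auto
  then show ?thesis
    using inner_laplacian[of G y] assms unfolding is_graph_def by simp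
qed

section \<open>The equilibrium and the payoff it induces\<close>

lemma mat_add_scaled_mult:
  fixes A :: "real ^ 'n ^ 'n"
  shows "(mat 1 + c *\<^sub>R A) *v x = x + c *\<^sub>R (A *v x)"
  by (simp add: matrix_vector_mult_add_rdistrib flip: scaleR_matrix_vector_assoc)

text \<open>Adding a nonnegative multiple of the positive semidefinite Laplacian to the identity
  gives a positive definite matrix, so its kernel is trivial and the inverse picked by
  \<open>matrix_inv\<close> is a genuine two-sided one.\<close>

lemma equilibrium_matrix_inverse:
  assumes "is_graph G" "\<beta> \<ge> 0"
  shows "(mat 1 + \<beta> *\<^sub>R laplacian G) ** equilibrium_matrix \<beta> G = mat 1"
    and "equilibrium_matrix \<beta> G ** (mat 1 + \<beta> *\<^sub>R laplacian G) = mat 1"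
proof -
  let ?A = "mat 1 + \<beta> *\<^sub>R laplacian G"
  have "x = 0" if "?A *v x = 0" for x
  proof -
    have "0 = x \<bullet> (?A *v x)" using that by simp
    also have "\<dots> = x \<bullet> x + \<beta> * (x \<bullet> (laplacian G *v x))"
      by (simp add: mat_add_scaled_mult inner_add_right)
    finally have "x \<bullet> x \<le> 0"
      using inner_laplacian_nonneg[OF assms(1), of x] assms(2)
      by (smt (verit) mult_nonneg_nonneg)
    then show ?thesis
      by (metis inner_ge_zero inner_eq_zero_iff order_antisym)
  qed
  then obtain B where "B ** ?A = mat 1"
    using matrix_left_invertible_ker by blast
  then have "invertible ?A"
    using invertible_left_inverse by blast
  then have "?A ** equilibrium_matrix \<beta> G = mat 1 \<and> equilibrium_matrix \<beta> G ** ?A = mat 1"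
    unfolding equilibrium_matrix_def matrix_inv_def invertible_def by (rule someI_ex)
  then show "?A ** equilibrium_matrix \<beta> G = mat 1" "equilibrium_matrix \<beta> G ** ?A = mat 1"
    by auto
qed

text \<open>These are the agents' first-order conditions at posterior mean \<open>y\<close>.\<close>

lemma equilibrium_matrix_mult:
  assumes "is_graph G" "\<beta> \<ge> 0"
  shows "equilibrium_matrix \<beta> G *v y + \<beta> *\<^sub>R (laplacian G *v (equilibrium_matrix \<beta> G *v y)) = y"
  using equilibrium_matrix_inverse(1)[OF assms]
  by (metis mat_add_scaled_mult matrix_vector_mul_assoc matrix_vector_mul_lid)

lemma transpose_equilibrium_matrix:
  assumes "is_graph G" "\<beta> \<ge> 0"
  shows "transpose (equilibrium_matrix \<beta> G) = equilibrium_matrix \<beta> G"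
proof -
  let ?A = "mat 1 + \<beta> *\<^sub>R laplacian G" and ?B = "equilibrium_matrix \<beta> G"
  have "transpose (laplacian G) = laplacian G"
    using assms(1) unfolding is_graph_def by (intro transpose_laplacian) auto
  then have "transpose ?A = ?A"
    unfolding transpose_def vec_eq_iff by (auto simp: mat_def)
  then have "transpose ?B ** ?A = mat 1"
    using equilibrium_matrix_inverse(1)[OF assms] by (metis matrix_transpose_mul transpose_mat)
  then show ?thesis
    using equilibrium_matrix_inverse(1)[OF assms]
    by (metis matrix_mul_assoc matrix_mul_lid matrix_mul_rid)
qed

text \<open>Moving the outer factor of \<open>V_matrix\<close> across the inner product rewrites the
  form in terms of actions. The bilinear version is kept because it also identifies
  \<open>V *v 1\<close>.\<close>

lemma inner_V_matrix:
  assumes "is_graph G" "\<beta> \<ge> 0"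
  defines "a \<equiv> \<lambda>y. equilibrium_matrix \<beta> G *v y"
  shows "x \<bullet> (V_matrix \<beta> G Gt *v y)
      = a x \<bullet> a y - 2 * \<beta> * (a x \<bullet> ((laplacian Gt - laplacian G) *v a y))"
proof -
  have "V_matrix \<beta> G Gt *v y = transpose (equilibrium_matrix \<beta> G) *v
      (a y - (2 * \<beta>) *\<^sub>R ((laplacian Gt - laplacian G) *v a y))"
    unfolding V_matrix_def a_def
    by (simp add: matrix_vector_mul_assoc[symmetric] matrix_vector_mult_diff_rdistrib
        scaleR_matrix_vector_assoc[symmetric] del: transpose_matrix_vector)
  then show ?thesis
    unfolding a_def by (simp add: inner_mult_eq_transpose_mult[of x "transpose _"] inner_diff_right
        del: transpose_matrix_vector)
qed

lemma transpose_V_matrix: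
  assumes "is_graph G" "is_graph Gt"
  shows "transpose (V_matrix \<beta> G Gt) = V_matrix \<beta> G Gt"
proof -
  have "transpose (laplacian G) = laplacian G" "transpose (laplacian Gt) = laplacian Gt"
    using assms unfolding is_graph_def by (auto intro: transpose_laplacian)
  then have "transpose (mat 1 - (2 * \<beta>) *\<^sub>R (laplacian Gt - laplacian G))
      = mat 1 - (2 * \<beta>) *\<^sub>R (laplacian Gt - laplacian G)"
    unfolding transpose_def vec_eq_iff by (auto simp: mat_def)
  then show ?thesis
    unfolding V_matrix_def by (simp add: matrix_transpose_mul transpose_transpose matrix_mul_assoc)
qed

text \<open>The payoff is split into a quadratic form in \<open>y\<close>, a term outside the
  signal's control, and a term linear in the estimation error \<open>x - y\<close>, which vanishes
  in expectation.\<close>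

lemma principal_payoff_equilibrium:
  fixes x y :: "real ^ 'n"
  assumes "is_graph G" "is_graph Gt" "\<beta> \<ge> 0"
  defines "a \<equiv> equilibrium_matrix \<beta> G *v y"
  shows "principal_payoff \<beta> Gt a x = y \<bullet> (V_matrix \<beta> G Gt *v y) - x \<bullet> x + 2 * (a \<bullet> (x - y))"
proof -
  have "(\<Sum>i\<in>UNIV. (a $ i - x $ i)\<^sup>2) = (a - x) \<bullet> (a - x)"
    by (simp add: inner_vec_def power2_eq_square)
  moreover have "a + \<beta> *\<^sub>R (laplacian G *v a) = y"
    unfolding a_def by (rule equilibrium_matrix_mult[OF assms(1,3)])
  \<comment> \<open>The first-order condition paired with \<open>a\<close> trades the linear term
    \<open>a \<bullet> y\<close> for quadratic forms in \<open>a\<close>; this is how the Laplacian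
    of \<open>G\<close> enters \<open>V_matrix\<close>.\<close>
  then have "a \<bullet> a + \<beta> * (a \<bullet> (laplacian G *v a)) = a \<bullet> y"
    by (metis inner_add_right inner_scaleR_right)
  ultimately show ?thesis
    unfolding principal_payoff_def inner_V_matrix[OF assms(1,3)] a_def[symmetric]
    using inner_laplacian[of Gt a] assms(2)
    by (simp add: is_graph_def matrix_vector_mult_diff_rdistrib inner_diff_right inner_diff_left
        inner_commute algebra_simps)
qed

text \<open>The family has as many members as the dimension, so the matrix with rows
  \<open>z j\<close> is square and its right inverse, the transpose, is also a left inverse.\<close>

lemma orthonormal_family_expansion:
  fixes z :: "'n \<Rightarrow> real ^ 'n"
  assumes "\<And>i j. z i \<bullet> z j = (if i = j then 1 else 0)"
  shows "(\<Sum>j\<in>UNIV. (z j \<bullet> x) *\<^sub>R z j) = x"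
proof -
  define Z where "Z = (\<chi> j. z j)"
  have "Z ** transpose Z = mat 1"
    unfolding vec_eq_iff using assms
    by (simp add: Z_def matrix_matrix_mult_def transpose_def mat_def inner_vec_def)
  then have "transpose Z ** Z = mat 1"
    using matrix_left_right_inverse by blast
  then have "transpose Z *v (Z *v x) = x"
    by (simp add: matrix_vector_mul_assoc del: transpose_matrix_vector)
  moreover have "transpose Z *v (Z *v x) = (\<Sum>j\<in>UNIV. (z j \<bullet> x) *\<^sub>R z j)"
    unfolding vec_eq_iff
    by (simp add: Z_def matrix_vector_mult_def transpose_def inner_vec_def mult.commute
        del: transpose_matrix_vector)
  ultimately show ?thesis by simp
qed

text \<open>Diagonalising the form makes the directions \<open>z j\<close> separate, so that signals
  can be compared one \<open>j\<close> at a time.\<close>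

lemma orthonormal_eigenbasis_inner:
  assumes "orthonormal_eigenbasis A z \<omega>"
  shows "x \<bullet> (A *v x) = (\<Sum>j\<in>UNIV. \<omega> j * (z j \<bullet> x)\<^sup>2)"
proof -
  have *: "(\<Sum>j\<in>UNIV. (z j \<bullet> x) *\<^sub>R z j) = x"
    using assms unfolding orthonormal_eigenbasis_def by (intro orthonormal_family_expansion) auto
  have "A *v x = A *v (\<Sum>j\<in>UNIV. (z j \<bullet> x) *\<^sub>R z j)" by (simp add: *)
  also have "\<dots> = (\<Sum>j\<in>UNIV. (z j \<bullet> x) *\<^sub>R (\<omega> j *\<^sub>R z j))"
    using assms unfolding orthonormal_eigenbasis_def
    by (simp add: linear_sum[OF matrix_vector_mul_linear] matrix_vector_mult_scaleR)
  finally show ?thesis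
    by (simp add: inner_sum_right inner_commute power2_eq_square algebra_simps)
qed

subsection \<open>The Gaussian state\<close>

text \<open>The product formula for Lebesgue measure is indexed by \<open>Basis\<close>; the
  bijection sending \<open>i\<close> to \<open>axis i 1\<close> carries it over to
  coordinates.\<close>

lemma nn_integral_lborel_vec:
  fixes f :: "'n::finite \<Rightarrow> real \<Rightarrow> ennreal"
  assumes [measurable]: "\<And>i. f i \<in> borel_measurable borel"
  shows "(\<integral>\<^sup>+x. (\<Prod>i\<in>UNIV. f i (x $ i)) \<partial>(lborel :: (real ^ 'n) measure)) = (\<Prod>i\<in>UNIV. \<integral>\<^sup>+t. f i t \<partial>lborel)"
proof -
  define a where "a = (\<lambda>i::'n. axis i (1::real))"
  have inj: "inj a" unfolding a_def by (auto simp: inj_on_def axis_eq_axis)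
  have B: "(Basis :: (real ^ 'n) set) = range a" unfolding a_def Basis_vec_def by auto
  have "(\<integral>\<^sup>+x. (\<Prod>b\<in>Basis. f (inv a b) (x \<bullet> b)) \<partial>(lborel :: (real ^ 'n) measure))
      = (\<Prod>b\<in>Basis. \<integral>\<^sup>+t. f (inv a b) t \<partial>lborel)"
    by (rule nn_integral_lborel_prod) auto
  then show ?thesis
    unfolding B by (simp add: prod.reindex[OF inj] inv_f_f[OF inj]) (simp add: a_def inner_axis)
qed

definition state_density :: "real \<Rightarrow> real \<Rightarrow> real ^ 'n \<Rightarrow> real" where
  "state_density \<mu> \<sigma> x = (\<Prod>i\<in>UNIV. normal_density \<mu> \<sigma> (x $ i))"

lemma borel_measurable_state_density[measurable]: "state_density \<mu> \<sigma> \<in> borel_measurable borel"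
  unfolding state_density_def[abs_def] by measurable

lemma state_density_nonneg[simp]: "0 \<le> state_density \<mu> \<sigma> x"
  unfolding state_density_def by (intro prod_nonneg) auto

lemma state_dist_eq: "state_dist \<mu> \<sigma> = density lborel (\<lambda>x. ennreal (state_density \<mu> \<sigma> x))"
  unfolding state_dist_def state_density_def ..

lemma sets_state_dist[simp, measurable_cong]: "sets (state_dist \<mu> \<sigma>) = sets borel"
  by (simp add: state_dist_def)

lemma space_state_dist[simp]: "space (state_dist \<mu> \<sigma>) = UNIV"
  by (simp add: state_dist_def)

lemma nn_integral_normal_density: "\<sigma> > 0 \<Longrightarrow> (\<integral>\<^sup>+t. ennreal (normal_density \<mu> \<sigma> t) \<partial>lborel) = 1"
  by (subst nn_integral_eq_integral) auto

lemma prob_space_state_dist: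
  assumes "\<sigma> > 0"
  shows "prob_space (state_dist \<mu> \<sigma> :: (real ^ 'n) measure)"
proof
  show "emeasure (state_dist \<mu> \<sigma>) (space (state_dist \<mu> \<sigma> :: (real ^ 'n) measure)) = 1"
    using nn_integral_lborel_vec[of "\<lambda>_ t. ennreal (normal_density \<mu> \<sigma> t)"]
    by (simp add: state_dist_def emeasure_density prod_ennreal nn_integral_normal_density[OF assms])
qed

text \<open>The integral factorises over coordinates: coordinate \<open>i\<close> contributes the
  variance of a normal distribution, every other one its total mass.\<close>

lemma integrable_state_dist_square:
  fixes i :: "'n::finite"
  assumes "\<sigma> > 0"
  shows "integrable (state_dist \<mu> \<sigma>) (\<lambda>x :: real ^ 'n. (x $ i - \<mu>)\<^sup>2)"
proof (rule integrableI_bounded)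
  let ?f = "\<lambda>j t. ennreal (normal_density \<mu> \<sigma> t * (if j = i then (t - \<mu>)\<^sup>2 else 1))"
  have "(\<integral>\<^sup>+x. ennreal (norm ((x $ i - \<mu>)\<^sup>2)) \<partial>(state_dist \<mu> \<sigma> :: (real ^ 'n) measure))
      = (\<integral>\<^sup>+x. (\<Prod>j\<in>UNIV. ?f j (x $ j)) \<partial>(lborel :: (real ^ 'n) measure))"
    unfolding state_dist_eq
    by (simp add: nn_integral_density prod_ennreal prod.distrib state_density_def prod_nonneg
        flip: ennreal_mult)
  also have "\<dots> = (\<Prod>j\<in>UNIV. \<integral>\<^sup>+t. ?f j t \<partial>lborel)"
    by (rule nn_integral_lborel_vec) auto
  also have "\<dots> < \<infinity>"
  proof -
    have "(\<integral>\<^sup>+t. ?f j t \<partial>lborel) < \<infinity>" for j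
      using integrable_normal_moment[OF assms, of \<mu> 2]
      by (cases "j = i") (auto simp: nn_integral_eq_integral assms)
    then have "(\<Prod>j\<in>A. \<integral>\<^sup>+t. ?f j t \<partial>lborel) < \<infinity>" for A
      by (induction A rule: infinite_finite_induct) (auto simp: ennreal_mult_less_top)
    then show ?thesis .
  qed
  finally show "(\<integral>\<^sup>+x. ennreal (norm ((x $ i - \<mu>)\<^sup>2)) \<partial>(state_dist \<mu> \<sigma> :: (real ^ 'n) measure)) < \<infinity>" .
qed simp

section \<open>Integrability from finite second moments\<close>

lemma integrable_of_square:
  fixes f :: "'a \<Rightarrow> real"
  assumes "finite_measure M" "f \<in> borel_measurable M" "integrable M (\<lambda>x. (f x)\<^sup>2)"
  shows "integrable M f"
proof -
  interpret finite_measure M by fact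
  show ?thesis
  proof (rule Bochner_Integration.integrable_bound)
    show "integrable M (\<lambda>x. 1 + (f x)\<^sup>2)" using assms by simp
    have "\<bar>t\<bar> \<le> 1 + t\<^sup>2" for t :: real
      using sum_squares_bound[of "\<bar>t\<bar>" 1] by simp
    then show "AE x in M. norm (f x) \<le> norm (1 + (f x)\<^sup>2)" by (auto simp: abs_of_nonneg add_nonneg_nonneg)
  qed fact
qed

lemma integrable_mult_of_squares:
  fixes f g :: "'a \<Rightarrow> real"
  assumes "f \<in> borel_measurable M" "g \<in> borel_measurable M"
    and "integrable M (\<lambda>x. (f x)\<^sup>2)" "integrable M (\<lambda>x. (g x)\<^sup>2)"
  shows "integrable M (\<lambda>x. f x * g x)"
proof (rule Bochner_Integration.integrable_bound)
  show "integrable M (\<lambda>x. (f x)\<^sup>2 + (g x)\<^sup>2)" using assms by simp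
  have "\<bar>s * t\<bar> \<le> s\<^sup>2 + t\<^sup>2" for s t :: real
  proof -
    have "0 \<le> \<bar>s\<bar> * \<bar>t\<bar>" by simp
    then show ?thesis
      using sum_squares_bound[of "\<bar>s\<bar>" "\<bar>t\<bar>"] unfolding abs_mult power2_abs by linarith
  qed
  then show "AE x in M. norm (f x * g x) \<le> norm ((f x)\<^sup>2 + (g x)\<^sup>2)" by auto
qed (use assms in simp)

lemma integrable_state_dist:
  fixes i :: "'n::finite"
  assumes "\<sigma> > 0"
  shows "integrable (state_dist \<mu> \<sigma>) (\<lambda>x :: real ^ 'n. x $ i)"
    and "integrable (state_dist \<mu> \<sigma>) (\<lambda>x :: real ^ 'n. (x $ i)\<^sup>2)"
proof -
  interpret prob_space "state_dist \<mu> \<sigma> :: (real ^ 'n) measure"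
    by (rule prob_space_state_dist[OF assms])
  have *: "integrable (state_dist \<mu> \<sigma>) (\<lambda>x :: real ^ 'n. x $ i - \<mu>)"
    by (rule integrable_of_square[OF _ _ integrable_state_dist_square[OF assms]]) (simp_all, unfold_locales)
  then have "integrable (state_dist \<mu> \<sigma>) (\<lambda>x :: real ^ 'n. (x $ i - \<mu>) + \<mu>)"
    by (intro Bochner_Integration.integrable_add) auto
  then show "integrable (state_dist \<mu> \<sigma>) (\<lambda>x :: real ^ 'n. x $ i)" by simp
  have "integrable (state_dist \<mu> \<sigma>) (\<lambda>x :: real ^ 'n. (x $ i - \<mu>)\<^sup>2 + 2 * \<mu> * (x $ i - \<mu>) + \<mu>\<^sup>2)"
    using * integrable_state_dist_square[OF assms]
    by (intro Bochner_Integration.integrable_add) auto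
  then show "integrable (state_dist \<mu> \<sigma>) (\<lambda>x :: real ^ 'n. (x $ i)\<^sup>2)"
    by (simp add: power2_eq_square algebra_simps)
qed

text \<open>Expand the square in each exponent. The cross terms add up to an inner product with
  \<open>u\<close>, and the terms in \<open>t\<close> squared add up to the squared norm of
  \<open>u\<close>, which is 1.\<close>

lemma state_density_translate:
  fixes x u :: "real ^ 'n"
  assumes "norm u = 1"
  shows "state_density \<mu> \<sigma> (x + t *\<^sub>R u)
    = state_density \<mu> \<sigma> x * exp (- (2 * t * (u \<bullet> (x - (\<chi> i. \<mu>))) + t\<^sup>2) / (2 * \<sigma>\<^sup>2))"
proof -
  let ?c = "\<chi> i. \<mu> :: real ^ 'n"
  have *: "- (a + t * b - \<mu>)\<^sup>2 / (2 * \<sigma>\<^sup>2)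
      = - (a - \<mu>)\<^sup>2 / (2 * \<sigma>\<^sup>2) + - (2 * t * (b * (a - \<mu>)) + t\<^sup>2 * b\<^sup>2) / (2 * \<sigma>\<^sup>2)" for a b
    unfolding add_divide_distrib[symmetric] by (rule arg_cong[of _ _ "\<lambda>r. r / _"]) algebra
  have "state_density \<mu> \<sigma> (x + t *\<^sub>R u)
      = state_density \<mu> \<sigma> x * (\<Prod>i\<in>UNIV. exp (- (2 * t * (u $ i * (x $ i - \<mu>)) + t\<^sup>2 * (u $ i)\<^sup>2) / (2 * \<sigma>\<^sup>2)))"
    unfolding state_density_def prod.distrib[symmetric]
    by (intro prod.cong refl)
      (simp only: normal_density_def * exp_add mult.assoc vector_add_component vector_scaleR_component real_scaleR_def)
  also have "(\<Prod>i\<in>UNIV. exp (- (2 * t * (u $ i * (x $ i - \<mu>)) + t\<^sup>2 * (u $ i)\<^sup>2) / (2 * \<sigma>\<^sup>2)))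
      = exp (- (2 * t * (u \<bullet> (x - ?c)) + t\<^sup>2 * (u \<bullet> u)) / (2 * \<sigma>\<^sup>2))"
    by (simp add: exp_sum[symmetric] inner_vec_def sum_distrib_left sum.distrib sum_negf sum_subtractf power2_eq_square
        flip: sum_divide_distrib)
  also have "u \<bullet> u = 1" using assms by (simp add: dot_square_norm)
  finally show ?thesis by simp
qed

text \<open>For a weight that is invariant along \<open>u\<close>, translating the Gaussian along \<open>u\<close> does not change
  the total weight; the first-order term of this identity in the translation length is the claim.\<close>

lemma integral_state_dist_invariant_weight:
  fixes g :: "real ^ 'n \<Rightarrow> real" and u :: "real ^ 'n"
  assumes \<sigma>: "\<sigma> > 0" and u: "norm u = 1"
    and [measurable]: "g \<in> borel_measurable borel"
    and g: "\<And>x. 0 \<le> g x" "\<And>x. g x \<le> 1"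
    and inv: "\<And>x t. g (x + t *\<^sub>R u) = g x"
  shows "(\<integral>x. g x * (u \<bullet> (x - (\<chi> i. \<mu>))) \<partial>state_dist \<mu> \<sigma>) = 0"
proof -
  interpret prob_space "state_dist \<mu> \<sigma> :: (real ^ 'n) measure"
    by (rule prob_space_state_dist[OF \<sigma>])
  let ?S = "state_dist \<mu> \<sigma> :: (real ^ 'n) measure"
  let ?D = "state_density \<mu> \<sigma> :: real ^ 'n \<Rightarrow> real"
  define s where "s = (\<lambda>x :: real ^ 'n. u \<bullet> (x - (\<chi> i. \<mu>)))"
  have [measurable]: "s \<in> borel_measurable borel" unfolding s_def by measurable
  have "integrable ?S s"
    unfolding s_def inner_vec_def using integrable_state_dist(1)[OF \<sigma>]
    by (auto intro!: Bochner_Integration.integrable_sum Bochner_Integration.integrable_diff integrable_mult_right)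
  then have int_gs: "integrable ?S (\<lambda>x. g x * s x)"
    by (rule Bochner_Integration.integrable_bound)
      (auto simp: abs_mult g intro!: mult_left_le_one_le)
  have int_g: "integrable ?S g"
    by (rule Bochner_Integration.integrable_bound[of _ "\<lambda>_. 1 :: real"]) (simp_all add: g)
  define m where "m = (\<integral>x. g x \<partial>?S)"
  define E where "E = (\<integral>x. g x * s x \<partial>?S)"
  have "m \<le> 1"
    unfolding m_def using integral_mono[OF int_g, of "\<lambda>_. 1"] g prob_space by simp
  \<comment> \<open>The bound \<open>exp r \<ge> 1 + r\<close> gives a one-sided first-order
    estimate for every real \<open>t\<close>, which avoids differentiating under the
    integral.\<close>
  have *: "t * E / \<sigma>\<^sup>2 \<ge> - (t\<^sup>2 / (2 * \<sigma>\<^sup>2)) * m" for t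
  proof -
    have "m = (\<integral>x. ?D x * g x \<partial>lborel)"
      unfolding m_def state_dist_eq by (subst integral_real_density) auto
    \<comment> \<open>Translation invariance of Lebesgue measure; afterwards the invariance of
      \<open>g\<close> leaves only the density changed.\<close>
    also have "\<dots> = (\<integral>x. ?D (x + t *\<^sub>R u) * g (x + t *\<^sub>R u) \<partial>lborel)"
      by (subst lborel_distr_plus[of "t *\<^sub>R u", symmetric], subst integral_distr) (auto simp: add.commute)
    also have "\<dots> = (\<integral>x. ?D x * (exp (- (2 * t * s x + t\<^sup>2) / (2 * \<sigma>\<^sup>2)) * g x) \<partial>lborel)"
      by (simp add: inv state_density_translate[OF u] s_def mult.assoc)
    also have "\<dots> \<ge> (\<integral>x. ?D x * (g x - t / \<sigma>\<^sup>2 * (g x * s x) - t\<^sup>2 / (2 * \<sigma>\<^sup>2) * g x) \<partial>lborel)"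
    proof (rule integral_mono)
      have "integrable ?S (\<lambda>x. g x - t / \<sigma>\<^sup>2 * (g x * s x) - t\<^sup>2 / (2 * \<sigma>\<^sup>2) * g x)"
        using int_g int_gs by auto
      then show "integrable lborel (\<lambda>x. ?D x * (g x - t / \<sigma>\<^sup>2 * (g x * s x) - t\<^sup>2 / (2 * \<sigma>\<^sup>2) * g x))"
        unfolding state_dist_eq by (subst (asm) integrable_real_density) auto
      have "integrable lborel (\<lambda>x. ?D x * g x)"
        using int_g unfolding state_dist_eq by (subst (asm) integrable_real_density) auto
      then have "integrable (distr lborel borel ((+) (t *\<^sub>R u))) (\<lambda>x. ?D x * g x)"
        by (simp add: lborel_distr_plus)
      then have "integrable lborel (\<lambda>x. ?D (x + t *\<^sub>R u) * g (x + t *\<^sub>R u))"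
        by (subst (asm) integrable_distr_eq) (auto simp: add.commute)
      then show "integrable lborel (\<lambda>x. ?D x * (exp (- (2 * t * s x + t\<^sup>2) / (2 * \<sigma>\<^sup>2)) * g x))"
        by (simp add: inv state_density_translate[OF u] s_def mult.assoc)
      fix x
      have "1 + (- (2 * t * s x + t\<^sup>2) / (2 * \<sigma>\<^sup>2)) \<le> exp (- (2 * t * s x + t\<^sup>2) / (2 * \<sigma>\<^sup>2))"
        by (rule exp_ge_add_one_self)
      from mult_right_mono[OF this g(1)[of x]]
      have "g x - t / \<sigma>\<^sup>2 * (g x * s x) - t\<^sup>2 / (2 * \<sigma>\<^sup>2) * g x \<le> exp (- (2 * t * s x + t\<^sup>2) / (2 * \<sigma>\<^sup>2)) * g x"
        by (rule order_trans[rotated]) (simp add: algebra_simps add_divide_distrib diff_divide_distrib)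
      then show "?D x * (g x - t / \<sigma>\<^sup>2 * (g x * s x) - t\<^sup>2 / (2 * \<sigma>\<^sup>2) * g x)
          \<le> ?D x * (exp (- (2 * t * s x + t\<^sup>2) / (2 * \<sigma>\<^sup>2)) * g x)"
        by (rule mult_left_mono) simp
    qed
    also (xtrans) have "(\<integral>x. ?D x * (g x - t / \<sigma>\<^sup>2 * (g x * s x) - t\<^sup>2 / (2 * \<sigma>\<^sup>2) * g x) \<partial>lborel)
        = (\<integral>x. g x - t / \<sigma>\<^sup>2 * (g x * s x) - t\<^sup>2 / (2 * \<sigma>\<^sup>2) * g x \<partial>?S)"
      unfolding state_dist_eq by (subst integral_real_density) auto
    also have "\<dots> = m - t / \<sigma>\<^sup>2 * E - t\<^sup>2 / (2 * \<sigma>\<^sup>2) * m"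
      unfolding m_def E_def using int_g int_gs by simp
    finally show ?thesis by simp
  qed
  \<comment> \<open>At \<open>t = - E\<close> the linear term is minus
    \<open>E\<^sup>2 / \<sigma>\<^sup>2\<close>, while the error is at most half as large because
    \<open>m \<le> 1\<close>. Hence \<open>E\<close> must vanish.\<close>
  from *[of "- E"] have "E\<^sup>2 / \<sigma>\<^sup>2 \<le> E\<^sup>2 / \<sigma>\<^sup>2 * (m / 2)"
    by (simp add: power2_eq_square)
  also have "\<dots> \<le> E\<^sup>2 / \<sigma>\<^sup>2 * (1 / 2)"
    using \<open>m \<le> 1\<close> by (intro mult_left_mono) auto
  finally have "E\<^sup>2 / \<sigma>\<^sup>2 \<le> 0" by simp
  then have "E = 0" using \<sigma> by (simp add: divide_le_0_iff)
  then show ?thesis unfolding E_def s_def .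
qed

subsection \<open>Posterior means\<close>

text \<open>Conditional Jensen inequality for the convex function \<open>x\<^sup>2\<close>.\<close>

lemma (in finite_measure_subalgebra) integrable_real_cond_exp_square:
  assumes "f \<in> borel_measurable M" "integrable M (\<lambda>x. (f x)\<^sup>2)"
  shows "integrable M (\<lambda>x. (real_cond_exp M F f x)\<^sup>2)"
proof (rule integrable_convex_cond_exp[where I = UNIV])
  show "integrable M f"
    by (rule integrable_of_square[OF _ assms]) unfold_locales
  show "convex_on UNIV (\<lambda>x :: real. x\<^sup>2)"
    by (rule convex_on_realI[where f' = "\<lambda>x. 2 * x"]) (auto intro!: derivative_eq_intros)
qed (use assms in \<open>auto simp: emeasure_eq_measure\<close>)

text \<open>The first factor is measurable with respect to \<open>F\<close>, so conditioning the
  second one does not change the integral. In other words, the error of an estimate is orthogonal to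
  all estimates.\<close>

lemma (in finite_measure_subalgebra) integral_real_cond_exp_mult:
  assumes "f \<in> borel_measurable M" "integrable M (\<lambda>x. (f x)\<^sup>2)"
    and "g \<in> borel_measurable M" "integrable M (\<lambda>x. (g x)\<^sup>2)"
  shows "(\<integral>x. real_cond_exp M F f x * real_cond_exp M F g x \<partial>M) = (\<integral>x. real_cond_exp M F f x * g x \<partial>M)"
  by (rule real_cond_exp_intg(2))
    (use assms in \<open>auto intro!: integrable_mult_of_squares integrable_real_cond_exp_square\<close>)

text \<open>Conditional expectation is an orthogonal projection in the space of square-integrable
  functions; expanding the squared error gives Pythagoras.\<close>

lemma (in finite_measure_subalgebra) integral_real_cond_exp_square_le:
  assumes "f \<in> borel_measurable M" "integrable M (\<lambda>x. (f x)\<^sup>2)"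
  shows "(\<integral>x. (real_cond_exp M F f x)\<^sup>2 \<partial>M) \<le> (\<integral>x. (f x)\<^sup>2 \<partial>M)"
proof -
  let ?c = "real_cond_exp M F f"
  note c = integrable_real_cond_exp_square[OF assms]
  have cf: "integrable M (\<lambda>x. ?c x * f x)"
    by (intro integrable_mult_of_squares assms c) auto
  have "0 \<le> (\<integral>x. (f x - ?c x)\<^sup>2 \<partial>M)" by simp
  also have "\<dots> = (\<integral>x. (f x)\<^sup>2 - 2 * (?c x * f x) + (?c x)\<^sup>2 \<partial>M)"
    by (simp add: power2_eq_square algebra_simps)
  also have "\<dots> = (\<integral>x. (f x)\<^sup>2 \<partial>M) - 2 * (\<integral>x. ?c x * f x \<partial>M) + (\<integral>x. (?c x)\<^sup>2 \<partial>M)"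
    using assms c cf by simp
  also have "(\<integral>x. ?c x * f x \<partial>M) = (\<integral>x. (?c x)\<^sup>2 \<partial>M)"
    using integral_real_cond_exp_mult[OF assms assms] by (simp add: power2_eq_square)
  finally show ?thesis by simp
qed

section \<open>The joint distribution of state and message\<close>

lemma state_dist_in_prob_algebra:
  "\<sigma> > 0 \<Longrightarrow> state_dist \<mu> \<sigma> \<in> space (prob_algebra borel)"
  by (simp add: space_prob_algebra prob_space_state_dist)

text \<open>A single arbitrary public signal. The optimality proof interprets the locale twice, for
  a competitor and for \<open>phi_star\<close>.\<close>

locale informed_agents =
  fixes \<mu> \<sigma> :: real and M :: "'m measure" and K :: "real ^ 'n \<Rightarrow> 'm measure"
  assumes sigma_pos: "\<sigma> > 0" and signal: "public_signal M K"
begin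

abbreviation S :: "(real ^ 'n) measure" where "S \<equiv> state_dist \<mu> \<sigma>"
abbreviation J :: "((real ^ 'n) \<times> 'm) measure" where "J \<equiv> joint_dist \<mu> \<sigma> M K"
abbreviation F :: "((real ^ 'n) \<times> 'm) measure" where "F \<equiv> vimage_algebra (space J) snd M"
abbreviation xhat :: "(real ^ 'n) \<times> 'm \<Rightarrow> real ^ 'n" where "xhat \<equiv> posterior_mean \<mu> \<sigma> M K"

lemma measurable_K[measurable]: "K \<in> borel \<rightarrow>\<^sub>M prob_algebra M"
  using signal unfolding public_signal_def .

lemma measurable_joint_kernel[measurable]:
  "(\<lambda>x. K x \<bind> (\<lambda>m. return (borel \<Otimes>\<^sub>M M) (x, m))) \<in> borel \<rightarrow>\<^sub>M prob_algebra (borel \<Otimes>\<^sub>M M)"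
  by (rule measurable_bind_prob_space2[OF measurable_K]) simp

lemma prob_space_J: "prob_space J"
  unfolding joint_dist_def
  by (rule prob_space_bind'[OF state_dist_in_prob_algebra[OF sigma_pos] measurable_joint_kernel])

lemma sets_J[simp, measurable_cong]: "sets J = sets (borel \<Otimes>\<^sub>M M)"
  unfolding joint_dist_def
  by (rule sets_bind'[OF state_dist_in_prob_algebra[OF sigma_pos] measurable_joint_kernel])

lemma space_J: "space J = UNIV \<times> space M"
  using sets_eq_imp_space_eq[OF sets_J] by (simp add: space_pair_measure)

text \<open>Each \<open>K x\<close> has total mass 1, so integrating out the message returns the
  prior. This transfers integrals of functions of the state alone from \<open>J\<close> to
  \<open>S\<close>.\<close>

lemma distr_J_fst: "distr J borel fst = S"
proof -
  let ?N = "\<lambda>x. K x \<bind> (\<lambda>m. return (borel \<Otimes>\<^sub>M M) (x, m))"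
  have "distr J borel fst = S \<bind> (\<lambda>x. distr (?N x) borel fst)"
    unfolding joint_dist_def
    by (rule distr_bind[where K = "borel \<Otimes>\<^sub>M M"])
      (auto intro!: measurable_prob_algebraD simp: measurable_cong_sets[OF sets_state_dist refl])
  also have "\<dots> = S \<bind> (\<lambda>x. return borel x)"
  proof (rule bind_cong[OF refl])
    fix x :: "real ^ 'n"
    have Kx: "K x \<in> space (prob_algebra M)"
      using measurable_space[OF measurable_K, of x] by simp
    then have [measurable_cong]: "sets (K x) = sets M" and sp: "space (K x) = space M" and "prob_space (K x)"
      by (auto simp: space_prob_algebra dest: sets_eq_imp_space_eq)
    interpret prob_space "K x" by fact
    have "distr (?N x) borel fst = K x \<bind> (\<lambda>m. distr (return (borel \<Otimes>\<^sub>M M) (x, m)) borel fst)"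
      by (rule distr_bind[where K = "borel \<Otimes>\<^sub>M M"]) (auto simp: not_empty)
    also have "\<dots> = K x \<bind> (\<lambda>m. return borel x)"
      by (rule bind_cong[OF refl]) (subst distr_return, auto simp: sp space_pair_measure)
    also have "\<dots> = return borel x"
      by (rule bind_const') (auto intro!: prob_space_imp_subprob_space prob_space_return, unfold_locales)
    finally show "distr (?N x) borel fst = return borel x" .
  qed
  also have "\<dots> = S" by (rule bind_return'') simp
  finally show ?thesis .
qed

lemma subalgebra_F: "subalgebra J F"
proof -
  have "snd \<in> J \<rightarrow>\<^sub>M M" by measurable
  moreover have "sets F = {snd -` A \<inter> space J |A. A \<in> sets M}"
    by (rule sets_vimage_algebra2) (auto simp: space_J)
  ultimately show ?thesis
    unfolding subalgebra_def by (auto intro: measurable_sets simp del: sets_J)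
qed

sublocale finite_measure_subalgebra J F
proof -
  interpret prob_space J by (rule prob_space_J)
  show "finite_measure_subalgebra J F"
    by (intro finite_measure_subalgebra.intro finite_measure_subalgebra_axioms.intro subalgebra_F)
      unfold_locales
qed

lemma integral_J_fst:
  fixes f :: "real ^ 'n \<Rightarrow> real"
  assumes [measurable]: "f \<in> borel_measurable borel"
  shows "(\<integral>w. f (fst w) \<partial>J) = (\<integral>x. f x \<partial>S)"
  by (subst distr_J_fst[symmetric], subst integral_distr) auto

lemma integrable_J_fst:
  fixes f :: "real ^ 'n \<Rightarrow> real"
  assumes [measurable]: "f \<in> borel_measurable borel"
  shows "integrable J (\<lambda>w. f (fst w)) \<longleftrightarrow> integrable S f"
  by (subst distr_J_fst[symmetric], subst integrable_distr_eq) auto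

lemma integrable_inner_square:
  fixes u :: "real ^ 'n"
  shows "integrable S (\<lambda>x. (u \<bullet> x)\<^sup>2)"
proof -
  have "(u \<bullet> x)\<^sup>2 = (\<Sum>i\<in>UNIV. \<Sum>k\<in>UNIV. u $ i * u $ k * (x $ i * x $ k))" for x
    by (simp add: inner_vec_def power2_eq_square sum_product mult.assoc mult.left_commute)
  then show ?thesis
    by (auto intro!: Bochner_Integration.integrable_sum integrable_mult_right
        integrable_mult_of_squares integrable_state_dist[OF sigma_pos])
qed

lemma integrable_inner_J:
  fixes u :: "real ^ 'n"
  shows "integrable J (\<lambda>w. (u \<bullet> fst w)\<^sup>2)" "integrable J (\<lambda>w. u \<bullet> fst w)"
proof -
  show *: "integrable J (\<lambda>w. (u \<bullet> fst w)\<^sup>2)"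
    using integrable_inner_square by (subst integrable_J_fst) auto
  show "integrable J (\<lambda>w. u \<bullet> fst w)"
    by (rule integrable_of_square[OF _ _ *]) (unfold_locales, measurable)
qed

section \<open>Second moments of the posterior mean\<close>

lemma posterior_mean_component: "xhat w $ i = real_cond_exp J F (\<lambda>p. fst p $ i) w"
  by (simp add: posterior_mean_def Let_def)

lemma measurable_xhat_component[measurable]: "(\<lambda>w. xhat w $ i) \<in> borel_measurable J"
  unfolding posterior_mean_component by measurable

lemma measurable_xhat[measurable]: "xhat \<in> borel_measurable J"
  by (subst borel_measurable_euclidean_space)
    (auto simp: Basis_vec_def inner_axis posterior_mean_component)

text \<open>The posterior mean is defined coordinate by coordinate, and conditional expectations are
  linear only up to null sets, hence the almost-everywhere statement.\<close>

lemma inner_posterior_mean: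
  "AE w in J. u \<bullet> xhat w = real_cond_exp J F (\<lambda>p. u \<bullet> fst p) w"
proof -
  have int: "integrable J (\<lambda>p. fst p $ i)" for i
    using integrable_inner_J(2)[of "axis i 1"] by (simp add: inner_axis' )
  have "AE w in J. real_cond_exp J F (\<lambda>p. \<Sum>i\<in>UNIV. u $ i * fst p $ i) w
      = (\<Sum>i\<in>UNIV. real_cond_exp J F (\<lambda>p. u $ i * fst p $ i) w)"
    by (rule real_cond_exp_sum) (intro integrable_mult_right int)
  moreover have "AE w in J. \<forall>i\<in>UNIV. real_cond_exp J F (\<lambda>p. u $ i * fst p $ i) w
      = u $ i * real_cond_exp J F (\<lambda>p. fst p $ i) w"
    by (intro AE_finite_allI real_cond_exp_cmult int) auto
  ultimately show ?thesis
    by eventually_elim (simp add: inner_vec_def posterior_mean_component)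
qed

lemma integral_inner_posterior_mean_square:
  "(\<integral>w. (u \<bullet> xhat w)\<^sup>2 \<partial>J) = (\<integral>w. (real_cond_exp J F (\<lambda>p. u \<bullet> fst p) w)\<^sup>2 \<partial>J)"
  by (rule integral_cong_AE) (use inner_posterior_mean[of u] in auto)

lemma integrable_inner_posterior_mean_square:
  "integrable J (\<lambda>w. (u \<bullet> xhat w)\<^sup>2)"
proof -
  have "integrable J (\<lambda>w. (real_cond_exp J F (\<lambda>p. u \<bullet> fst p) w)\<^sup>2)"
    by (rule integrable_real_cond_exp_square[OF _ integrable_inner_J(1)]) simp
  then show ?thesis
    by (subst integrable_cong_AE) (use inner_posterior_mean[of u] in auto)
qed

lemma integral_inner_posterior_mean_square_le:
  "(\<integral>w. (u \<bullet> xhat w)\<^sup>2 \<partial>J) \<le> (\<integral>x. (u \<bullet> x)\<^sup>2 \<partial>S)"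
proof -
  have "(\<integral>w. (u \<bullet> xhat w)\<^sup>2 \<partial>J) \<le> (\<integral>w. (u \<bullet> fst w)\<^sup>2 \<partial>J)"
    unfolding integral_inner_posterior_mean_square
    by (rule integral_real_cond_exp_square_le[OF _ integrable_inner_J(1)]) simp
  also have "\<dots> = (\<integral>x. (u \<bullet> x)\<^sup>2 \<partial>S)"
    by (subst integral_J_fst) auto
  finally show ?thesis .
qed

text \<open>Conditioning preserves the mean, and the variance of the conditional expectation is
  nonnegative.\<close>

lemma integral_inner_posterior_mean_square_ge:
  "(\<integral>x. u \<bullet> x \<partial>S)\<^sup>2 \<le> (\<integral>w. (u \<bullet> xhat w)\<^sup>2 \<partial>J)"
proof -
  interpret prob_space J by (rule prob_space_J)
  let ?c = "real_cond_exp J F (\<lambda>p. u \<bullet> fst p)"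
  have 1: "integrable J ?c" and 2: "(\<integral>w. ?c w \<partial>J) = (\<integral>w. u \<bullet> fst w \<partial>J)"
    by (rule real_cond_exp_int[OF integrable_inner_J(2)])+
  have 3: "integrable J (\<lambda>w. (?c w)\<^sup>2)"
    by (rule integrable_real_cond_exp_square[OF _ integrable_inner_J(1)]) simp
  have "(\<integral>w. ?c w \<partial>J)\<^sup>2 \<le> (\<integral>w. (?c w)\<^sup>2 \<partial>J)"
    using variance_eq[OF 1 3] variance_positive[of ?c] by simp
  then show ?thesis
    by (simp add: 2 integral_inner_posterior_mean_square integral_J_fst)
qed

text \<open>The equilibrium action is linear in \<open>xhat\<close>, so its product with the error
  \<open>fst w - xhat w\<close> has zero expectation. What remains is the diagonalised quadratic
  form and a constant common to all signals.\<close>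

lemma expected_payoff_eq:
  assumes G: "is_graph G" "is_graph Gt" "\<beta> \<ge> 0"
    and z: "orthonormal_eigenbasis (V_matrix \<beta> G Gt) z \<omega>"
  shows "expected_payoff \<mu> \<sigma> \<beta> G Gt M K
     = (\<Sum>j\<in>UNIV. \<omega> j * (\<integral>w. (z j \<bullet> xhat w)\<^sup>2 \<partial>J)) - (\<integral>x. x \<bullet> x \<partial>S)"
proof -
  let ?B = "equilibrium_matrix \<beta> G"
  have meas: "(\<lambda>p. fst p $ i) \<in> borel_measurable J" for i
    using integrable_inner_J(2)[of "axis i 1"] by (simp add: inner_axis' borel_measurable_integrable)
  have sq: "integrable J (\<lambda>p. (fst p $ i)\<^sup>2)" for i
    using integrable_inner_J(1)[of "axis i 1"] by (simp add: inner_axis')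
  have sqh: "integrable J (\<lambda>w. (xhat w $ i)\<^sup>2)" for i
    using integrable_inner_posterior_mean_square[of "axis i 1"] by (simp add: inner_axis')
  have meash: "(\<lambda>w. xhat w $ i) \<in> borel_measurable J" for i
    by (rule measurable_xhat_component)
  have i1: "integrable J (\<lambda>w. xhat w $ k * fst w $ i)" for i k
    by (rule integrable_mult_of_squares[OF meash meas sqh sq])
  have i2: "integrable J (\<lambda>w. xhat w $ k * xhat w $ i)" for i k
    by (rule integrable_mult_of_squares[OF meash meash sqh sqh])
  \<comment> \<open>The estimation error is orthogonal to every coordinate of the estimate.\<close>
  have cross: "(\<integral>w. xhat w $ k * (fst w $ i - xhat w $ i) \<partial>J) = 0" for i k
    using integral_real_cond_exp_mult[OF meas sq meas sq, of k i] i1[of k i] i2[of k i]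
    by (simp add: right_diff_distrib posterior_mean_component)
  have i3: "integrable J (\<lambda>w. xhat w $ k * (fst w $ i - xhat w $ i))" for i k
    using i1[of k i] i2[of k i] by (simp add: right_diff_distrib)
  have exp: "(?B *v xhat w) \<bullet> (fst w - xhat w)
      = (\<Sum>i\<in>UNIV. \<Sum>k\<in>UNIV. ?B $ i $ k * (xhat w $ k * (fst w $ i - xhat w $ i)))" for w
    by (simp add: inner_vec_def matrix_vector_mult_def sum_distrib_right mult.assoc)
  have "(\<integral>w. (?B *v xhat w) \<bullet> (fst w - xhat w) \<partial>J) = 0"
    unfolding exp by (simp add: i3 cross)
  moreover have "integrable J (\<lambda>w. (?B *v xhat w) \<bullet> (fst w - xhat w))"
    unfolding exp by (auto intro!: Bochner_Integration.integrable_sum integrable_mult_right i3)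
  moreover have "integrable J (\<lambda>w. fst w \<bullet> fst w)"
    using sq by (simp add: inner_vec_def power2_eq_square)
  moreover have "(\<integral>w. fst w \<bullet> fst w \<partial>J) = (\<integral>x. x \<bullet> x \<partial>S)"
    by (subst integral_J_fst) auto
  moreover have "expected_payoff \<mu> \<sigma> \<beta> G Gt M K = (\<integral>w. (\<Sum>j\<in>UNIV. \<omega> j * (z j \<bullet> xhat w)\<^sup>2)
      - fst w \<bullet> fst w + 2 * ((?B *v xhat w) \<bullet> (fst w - xhat w)) \<partial>J)"
    unfolding expected_payoff_def
    by (simp add: principal_payoff_equilibrium[OF G] orthonormal_eigenbasis_inner[OF z])
  ultimately show ?thesis
    by (simp add: integrable_inner_posterior_mean_square)
qed

end

subsection \<open>Optimality of the spectral signal\<close>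

lemma measurable_disclosure[measurable]:
  assumes "f \<in> borel \<rightarrow>\<^sub>M M"
  shows "disclosure M f \<in> borel \<rightarrow>\<^sub>M prob_algebra M"
  unfolding disclosure_def by (rule measurable_compose[OF assms measurable_return_prob_space])

text \<open>The message is a function of the state, so the joint law is the prior pushed onto the
  graph of \<open>f\<close>.\<close>

lemma joint_dist_disclosure:
  fixes f :: "real ^ 'n \<Rightarrow> 'm"
  assumes [measurable]: "f \<in> borel \<rightarrow>\<^sub>M M"
  shows "joint_dist \<mu> \<sigma> M (disclosure M f)
    = distr (state_dist \<mu> \<sigma>) (borel \<Otimes>\<^sub>M M) (\<lambda>x. (x, f x))"
proof -
  have "return M (f x) \<bind> (\<lambda>m. return (borel \<Otimes>\<^sub>M M) (x, m)) = return (borel \<Otimes>\<^sub>M M) (x, f x)" for x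
    by (rule bind_return[where N = "borel \<Otimes>\<^sub>M M"]) (use measurable_space[OF assms, of x] in auto)
  then show ?thesis
    unfolding joint_dist_def disclosure_def by (simp add: bind_return_distr')
qed

lemma measurable_phi_star_statistic[measurable]:
  "(\<lambda>x. \<lambda>j\<in>{j. \<omega> j \<ge> 0}. z j \<bullet> x) \<in> borel \<rightarrow>\<^sub>M phi_star_space \<omega>"
  unfolding phi_star_space_def
  by (intro measurable_restrict borel_measurable_continuous_onI linear_continuous_on
      bounded_linear_inner_right)

lemma public_signal_phi_star: "public_signal (phi_star_space \<omega>) (phi_star z \<omega>)"
  unfolding public_signal_def phi_star_def by measurable

lemma measurable_phi_star_space_component:
  "\<omega> j \<ge> 0 \<Longrightarrow> (\<lambda>m. m j) \<in> borel_measurable (phi_star_space \<omega>)"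
  unfolding phi_star_space_def by (rule measurable_component_singleton) simp

section \<open>Moments under the spectral signal\<close>

context
  fixes \<mu> \<sigma> :: real and z :: "'n::finite \<Rightarrow> real ^ 'n" and \<omega> :: "'n \<Rightarrow> real"
  assumes sigma_pos: "\<sigma> > 0"
    and orthonormal: "\<And>i j. z i \<bullet> z j = (if i = j then 1 else 0)"
begin

interpretation informed_agents \<mu> \<sigma> "phi_star_space \<omega>" "phi_star z \<omega>"
  by unfold_locales (fact sigma_pos, rule public_signal_phi_star)

lemma joint_dist_phi_star:
  "J = distr S (borel \<Otimes>\<^sub>M phi_star_space \<omega>) (\<lambda>x. (x, \<lambda>j\<in>{j. \<omega> j \<ge> 0}. z j \<bullet> x))"
  unfolding phi_star_def by (rule joint_dist_disclosure) measurable

text \<open>Almost surely \<open>z j \<bullet> x\<close> equals coordinate \<open>j\<close> of the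
  message, which conditioning on the message leaves unchanged.\<close>

lemma phi_star_disclosed:
  assumes j: "\<omega> j \<ge> 0"
  shows "(\<integral>w. (z j \<bullet> xhat w)\<^sup>2 \<partial>J) = (\<integral>x. (z j \<bullet> x)\<^sup>2 \<partial>S)"
proof -
  note [measurable] = measurable_phi_star_space_component[where \<omega> = \<omega> and j = j, OF j]
  have [measurable]: "(\<lambda>w. snd w j) \<in> borel_measurable J" by measurable
  have "(\<lambda>w. snd w j) \<in> borel_measurable F"
    by (rule measurable_compose[OF measurable_vimage_algebra1 measurable_phi_star_space_component[where \<omega> = \<omega> and j = j, OF j]])
      (auto simp: space_J)
  have eq: "AE w in J. z j \<bullet> fst w = snd w j"
    unfolding joint_dist_phi_star by (subst AE_distr_iff) (auto simp: j)
  have int: "integrable J (\<lambda>w. snd w j)"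
    by (subst integrable_cong_AE[OF _ _ AE_symmetric[OF eq]]) (auto intro: integrable_inner_J)
  have "AE w in J. real_cond_exp J F (\<lambda>p. z j \<bullet> fst p) w = real_cond_exp J F (\<lambda>p. snd p j) w"
    by (rule real_cond_exp_cong[OF eq]) auto
  moreover have "AE w in J. real_cond_exp J F (\<lambda>p. snd p j) w = snd w j"
    by (rule real_cond_exp_F_meas) fact+
  ultimately have "AE w in J. (real_cond_exp J F (\<lambda>p. z j \<bullet> fst p) w)\<^sup>2 = (z j \<bullet> fst w)\<^sup>2"
    using eq by eventually_elim simp
  then have "(\<integral>w. (z j \<bullet> xhat w)\<^sup>2 \<partial>J) = (\<integral>w. (z j \<bullet> fst w)\<^sup>2 \<partial>J)"
    unfolding integral_inner_posterior_mean_square by (intro integral_cong_AE) auto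
  then show ?thesis
    using integral_J_fst[of "\<lambda>x. (z j \<bullet> x)\<^sup>2"] by simp
qed

text \<open>Moving the state along \<open>z j\<close> does not alter the message, by orthogonality.
  The indicator of a message event is thus an invariant weight, \<open>z j \<bullet> (x - c)\<close>
  integrates to zero over every such event, and the conditional expectation is the constant
  \<open>z j \<bullet> c\<close>.\<close>

lemma phi_star_concealed:
  assumes j: "\<omega> j < 0"
  shows "(\<integral>w. (z j \<bullet> xhat w)\<^sup>2 \<partial>J) = (\<integral>x. z j \<bullet> x \<partial>S)\<^sup>2"
proof -
  interpret J: prob_space J by (rule prob_space_J)
  interpret S: prob_space S by (rule prob_space_state_dist[OF sigma_pos])
  let ?f = "\<lambda>x. \<lambda>j\<in>{j. \<omega> j \<ge> 0}. z j \<bullet> x"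
  define c :: "real ^ 'n" where "c = (\<chi> i. \<mu>)"
  have nz: "norm (z j) = 1" using orthonormal[of j j] by (simp add: norm_eq_sqrt_inner)
  have int: "integrable S (\<lambda>x. z j \<bullet> x)"
    using integrable_inner_J(2)[of "z j"] by (subst (asm) integrable_J_fst) auto
  have zero: "(\<integral>x. indicator C (?f x) * (z j \<bullet> x - z j \<bullet> c) \<partial>S) = 0"
    if [measurable]: "C \<in> sets (phi_star_space \<omega>)" for C
    unfolding inner_diff_right[symmetric] c_def
  proof (rule integral_state_dist_invariant_weight[OF sigma_pos nz])
    show "(\<lambda>x. indicator C (?f x)) \<in> borel_measurable borel" by measurable
    fix x t
    have "?f (x + t *\<^sub>R z j) = ?f x"
      using j by (auto simp: restrict_def fun_eq_iff inner_add_right orthonormal)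
    then show "indicator C (?f (x + t *\<^sub>R z j)) = (indicator C (?f x) :: real)" by simp
  qed auto
  have mean: "(\<integral>x. z j \<bullet> x \<partial>S) = z j \<bullet> c"
  proof -
    \<comment> \<open>The constant weight 1 is invariant as well and yields the unconditional
      mean.\<close>
    have "(\<integral>x. 1 * (z j \<bullet> (x - c)) \<partial>S) = 0"
      unfolding c_def by (rule integral_state_dist_invariant_weight[OF sigma_pos nz]) auto
    then show ?thesis
      using int S.prob_space by (simp add: inner_diff_right)
  qed
  have "AE w in J. real_cond_exp J F (\<lambda>p. z j \<bullet> fst p) w = z j \<bullet> c"
  proof (rule real_cond_exp_charact)
    fix A assume "A \<in> sets F"
    moreover have "sets F = {snd -` A \<inter> space J |A. A \<in> sets (phi_star_space \<omega>)}"
      by (rule sets_vimage_algebra2) (auto simp: space_J)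
    ultimately obtain C where C[measurable]: "C \<in> sets (phi_star_space \<omega>)" and A: "A = snd -` C \<inter> space J"
      by blast
    have [measurable]: "A \<in> sets J" unfolding A by (rule measurable_sets[OF _ C]) measurable
    have ind: "integrable J (\<lambda>w. indicator A w * h w)" if "integrable J h" for h :: "_ \<Rightarrow> real"
      using integrable_mult_indicator[OF \<open>A \<in> sets J\<close> that] by simp
    have "(\<integral>w. indicator A w * (z j \<bullet> fst w) \<partial>J) - (\<integral>w. indicator A w * (z j \<bullet> c) \<partial>J)
        = (\<integral>w. indicator A w * (z j \<bullet> fst w) - indicator A w * (z j \<bullet> c) \<partial>J)"
      by (rule Bochner_Integration.integral_diff[symmetric]; rule ind) (auto intro: integrable_inner_J)
    also have "\<dots> = (\<integral>w. indicator C (snd w) * (z j \<bullet> fst w - z j \<bullet> c) \<partial>J)"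
      by (rule Bochner_Integration.integral_cong) (auto simp: A indicator_def)
    also have "\<dots> = (\<integral>x. indicator C (?f x) * (z j \<bullet> x - z j \<bullet> c) \<partial>S)"
      unfolding joint_dist_phi_star by (subst integral_distr) auto
    also have "\<dots> = 0" by (rule zero) fact
    finally show "(\<integral>w\<in>A. z j \<bullet> fst w \<partial>J) = (\<integral>w\<in>A. z j \<bullet> c \<partial>J)"
      by (simp add: set_lebesgue_integral_def)
  qed (auto intro: integrable_inner_J)
  then have "(\<integral>w. (z j \<bullet> xhat w)\<^sup>2 \<partial>J) = (\<integral>w. (z j \<bullet> c)\<^sup>2 \<partial>J)"
    unfolding integral_inner_posterior_mean_square by (intro integral_cong_AE) auto
  then show ?thesis using mean J.prob_space by simp
qed

end

lemma optimal_signal_phi_star: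
  fixes G Gt :: "real ^ 'n ^ 'n"
  assumes "\<sigma> > 0" "is_graph G" "is_graph Gt" "\<beta> \<ge> 0"
    and z: "orthonormal_eigenbasis (V_matrix \<beta> G Gt) z \<omega>"
  shows "optimal_signal TYPE('k) \<mu> \<sigma> \<beta> G Gt (phi_star_space \<omega>) (phi_star z \<omega>)"
  unfolding optimal_signal_def
proof (intro conjI allI impI)
  show "public_signal (phi_star_space \<omega>) (phi_star z \<omega>)" by (rule public_signal_phi_star)
  fix M' :: "'k measure" and K' :: "real ^ 'n \<Rightarrow> 'k measure"
  assume K': "public_signal M' K'"
  have orth: "z i \<bullet> z j = (if i = j then 1 else 0)" for i j
    using z unfolding orthonormal_eigenbasis_def by auto
  interpret A: informed_agents \<mu> \<sigma> M' K'
    by unfold_locales (fact assms(1), fact K')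
  interpret P: informed_agents \<mu> \<sigma> "phi_star_space \<omega>" "phi_star z \<omega>"
    by unfold_locales (fact assms(1), rule public_signal_phi_star)
  \<comment> \<open>Termwise comparison: \<open>phi_star\<close> attains the upper bound on the
    moment where \<open>\<omega> j\<close> is nonnegative and the lower bound where it is negative,
    and a negative factor reverses the inequality.\<close>
  have "\<omega> j * (\<integral>w. (z j \<bullet> A.xhat w)\<^sup>2 \<partial>A.J) \<le> \<omega> j * (\<integral>w. (z j \<bullet> P.xhat w)\<^sup>2 \<partial>P.J)" for j
  proof (cases "\<omega> j \<ge> 0")
    case True
    then show ?thesis
      unfolding phi_star_disclosed[where z = z and \<omega> = \<omega> and j = j, OF assms(1) orth True]
      by (intro mult_left_mono A.integral_inner_posterior_mean_square_le)
  next
    case False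
    then have "\<omega> j < 0" by simp
    then show ?thesis
      unfolding phi_star_concealed[where z = z and \<omega> = \<omega> and j = j, OF assms(1) orth \<open>\<omega> j < 0\<close>]
      by (intro mult_left_mono_neg A.integral_inner_posterior_mean_square_ge) simp
  qed
  then show "expected_payoff \<mu> \<sigma> \<beta> G Gt M' K' \<le> expected_payoff \<mu> \<sigma> \<beta> G Gt (phi_star_space \<omega>) (phi_star z \<omega>)"
    unfolding A.expected_payoff_eq[OF assms(2-4) z] P.expected_payoff_eq[OF assms(2-4) z]
    by (intro diff_mono sum_mono) auto
qed

subsection \<open>Complete synergy graph\<close>

lemma complement_graph_eq:
  assumes "is_graph G"
  shows "complement_graph G = complete_graph - G"
  unfolding vec_eq_iff
proof (intro allI)
  fix i j
  have "G $ i $ j = 0 \<or> G $ i $ j = 1" "G $ i $ i = 0"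
    using assms unfolding is_graph_def by auto
  then show "complement_graph G $ i $ j = (complete_graph - G) $ i $ j"
    by (auto simp: complement_graph_def complete_graph_def)
qed

lemma is_graph_complement_graph:
  assumes "is_graph G"
  shows "is_graph (complement_graph G)"
proof -
  have "G $ i $ j = G $ j $ i" for i j
    using assms unfolding is_graph_def by (metis transpose_def vec_lambda_beta)
  then show ?thesis
    unfolding is_graph_def by (auto simp: complement_graph_def transpose_def vec_eq_iff)
qed

text \<open>The Laplacian is linear in the adjacency matrix. For complete synergies, the difference
  inside \<open>V_matrix\<close> is therefore itself the Laplacian of a graph.\<close>

lemma laplacian_complement_graph:
  assumes "is_graph G"
  shows "laplacian (complement_graph G) = laplacian complete_graph - laplacian G"
  unfolding complement_graph_eq[OF assms] laplacian_def degree_matrix_def vec_eq_iff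
  by (auto simp: sum_subtractf)

section \<open>Laplacians of connected graphs\<close>

lemma laplacian_mult_ones: "laplacian G *v 1 = 0"
  by (simp add: vec_eq_iff laplacian_mult_component)

text \<open>A vanishing sum of nonnegative terms makes \<open>y\<close> agree across every edge, and
  equality then spreads along paths.\<close>

lemma connected_laplacian_kernel:
  assumes H: "is_graph H" "graph_connected H" and "y \<bullet> (laplacian H *v y) = 0"
  shows "y $ i = y $ j"
proof -
  have H01: "H $ k $ l = 0 \<or> H $ k $ l = 1" for k l
    using H(1) unfolding is_graph_def by auto
  then have nonneg: "0 \<le> H $ k $ l * (y $ k - y $ l)\<^sup>2" for k l
    by (metis mult_nonneg_nonneg order_refl zero_le_one zero_le_power2)
  have "(\<Sum>k\<in>UNIV. \<Sum>l\<in>UNIV. H $ k $ l * (y $ k - y $ l)\<^sup>2) = 0"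
    using inner_laplacian[of H y] assms unfolding is_graph_def by simp
  then have "H $ k $ l * (y $ k - y $ l)\<^sup>2 = 0" for k l
    by (simp add: sum_nonneg_eq_0_iff nonneg sum_nonneg)
  then have edge: "y $ k = y $ l" if "H $ k $ l = 1" for k l
    using that by (metis eq_iff_diff_eq_0 mult_1 power_eq_0_iff)
  have "(i, j) \<in> {(k, l). H $ k $ l = 1}\<^sup>*"
    using H(2) unfolding graph_connected_def by auto
  then show ?thesis
    by (induction rule: rtrancl_induct) (auto dest: edge)
qed

lemma inner_ones: "y \<bullet> (1 :: real ^ 'n) = (\<Sum>i\<in>UNIV. y $ i)"
  by (simp add: inner_vec_def)

text \<open>The form is positive on the compact set of unit vectors orthogonal to \<open>1\<close>,
  so it has a positive minimum there; homogeneity extends the bound to all vectors orthogonal to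
  \<open>1\<close>.\<close>

lemma connected_laplacian_coercive:
  fixes H :: "real ^ 'n ^ 'n"
  assumes H: "is_graph H" "graph_connected H"
  shows "\<exists>c>0. \<forall>y. y \<bullet> 1 = 0 \<longrightarrow> c * (y \<bullet> y) \<le> y \<bullet> (laplacian H *v y)"
proof -
  let ?q = "\<lambda>y. y \<bullet> (laplacian H *v y)"
  define T :: "(real ^ 'n) set" where "T = sphere 0 1 \<inter> {y. y \<bullet> 1 = 0}"
  have "compact T"
    unfolding T_def by (intro compact_Int_closed compact_sphere closed_Collect_eq continuous_intros)
  have cont: "continuous_on T ?q"
    by (intro continuous_intros linear_continuous_on matrix_vector_mul_bounded_linear)
  have pos: "?q y > 0" if "y \<in> T" for y
  proof (rule ccontr)
    assume "\<not> ?q y > 0"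
    then have "?q y = 0" using inner_laplacian_nonneg[OF H(1), of y] by simp
    then have eq: "y $ i = y $ j" for i j by (rule connected_laplacian_kernel[OF H])
    \<comment> \<open>A constant vector whose entries sum to zero is zero.\<close>
    have "real CARD('n) * y $ i = 0" for i
    proof -
      have "(\<Sum>l\<in>UNIV. y $ l) = (\<Sum>l\<in>(UNIV :: 'n set). y $ i)"
        by (intro sum.cong refl eq)
      then show ?thesis using that unfolding T_def inner_ones by simp
    qed
    then have "y = 0" by (simp add: vec_eq_iff)
    then show False using that unfolding T_def by simp
  qed
  obtain c where c: "c > 0" "\<And>y. y \<in> T \<Longrightarrow> c \<le> ?q y"
  proof (cases "T = {}")
    case True
    \<comment> \<open>With one agent there is no such unit vector and any positive constant
      serves.\<close>
    then show ?thesis using that[of 1] by simp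
  next
    case False
    then obtain x where "x \<in> T" "\<forall>y\<in>T. ?q x \<le> ?q y"
      using continuous_attains_inf[OF \<open>compact T\<close> _ cont] by blast
    then show ?thesis using that[of "?q x"] pos by blast
  qed
  have "c * (y \<bullet> y) \<le> ?q y" if "y \<bullet> 1 = 0" for y
  proof (cases "y = 0")
    case False
    let ?u = "(1 / norm y) *\<^sub>R y"
    have "?u \<in> T" using False that unfolding T_def by simp
    then have "c \<le> ?q ?u" by (rule c)
    also have "\<dots> = ?q y / (norm y)\<^sup>2"
      by (simp add: matrix_vector_mult_scaleR power2_eq_square)
    finally show ?thesis
      using False by (simp add: pos_le_divide_eq dot_square_norm)
  qed simp
  then show ?thesis using c(1) by blast
qed

section \<open>The spectrum of the payoff matrix\<close>

lemma equilibrium_matrix_mult_ones: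
  assumes "is_graph G" "\<beta> \<ge> 0"
  shows "equilibrium_matrix \<beta> G *v 1 = 1"
proof -
  have "(mat 1 + \<beta> *\<^sub>R laplacian G) *v 1 = 1"
    by (simp add: mat_add_scaled_mult laplacian_mult_ones)
  then show ?thesis
    using equilibrium_matrix_inverse(2)[OF assms]
    by (metis matrix_vector_mul_assoc matrix_vector_mul_lid)
qed

lemma V_matrix_mult_ones:
  assumes "is_graph G" "\<beta> \<ge> 0"
  shows "V_matrix \<beta> G Gt *v 1 = 1"
proof -
  have "x \<bullet> (V_matrix \<beta> G Gt *v 1) = x \<bullet> 1" for x
  proof -
    have "(equilibrium_matrix \<beta> G *v x) \<bullet> 1 = x \<bullet> 1"
      using inner_mult_eq_transpose_mult[of x "equilibrium_matrix \<beta> G" 1]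
      by (metis assms equilibrium_matrix_mult_ones transpose_equilibrium_matrix)
    then show ?thesis
      by (simp add: inner_V_matrix[OF assms] equilibrium_matrix_mult_ones[OF assms]
          matrix_vector_mult_diff_rdistrib laplacian_mult_ones)
  qed
  then show ?thesis by (metis vector_eq_ldot)
qed

text \<open>The equilibrium matrix is symmetric and fixes \<open>1\<close>, so the action vector
  \<open>?a\<close> is again orthogonal to \<open>1\<close>. By coercivity the form is at most
  \<open>(1 - 2 * \<beta> * c) * (?a \<bullet> ?a)\<close>, and \<open>?a\<close> is nonzero with
  \<open>y\<close>.\<close>

lemma V_matrix_negative:
  fixes G Gt :: "real ^ 'n ^ 'n"
  assumes "is_graph G" "\<beta> \<ge> 0" "2 * \<beta> * c > 1"
    and c: "\<And>y. y \<bullet> 1 = 0 \<Longrightarrow> c * (y \<bullet> y) \<le> y \<bullet> ((laplacian Gt - laplacian G) *v y)"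
    and y: "y \<bullet> 1 = 0" "y \<noteq> 0"
  shows "y \<bullet> (V_matrix \<beta> G Gt *v y) < 0"
proof -
  let ?a = "equilibrium_matrix \<beta> G *v y"
  have "?a \<bullet> 1 = y \<bullet> 1"
    using inner_mult_eq_transpose_mult[of y "equilibrium_matrix \<beta> G" 1]
    by (metis assms(1,2) equilibrium_matrix_mult_ones transpose_equilibrium_matrix)
  then have "?a \<bullet> 1 = 0" using y by simp
  then have "c * (?a \<bullet> ?a) \<le> ?a \<bullet> ((laplacian Gt - laplacian G) *v ?a)" by (rule c)
  then have "2 * \<beta> * (c * (?a \<bullet> ?a)) \<le> 2 * \<beta> * (?a \<bullet> ((laplacian Gt - laplacian G) *v ?a))"
    using assms(2) by (intro mult_left_mono) auto
  moreover have "?a \<noteq> 0"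
    using equilibrium_matrix_mult[OF assms(1,2), of y] y by auto
  then have "1 * (?a \<bullet> ?a) < 2 * \<beta> * c * (?a \<bullet> ?a)"
    using assms(3) by (intro mult_strict_right_mono) auto
  ultimately show ?thesis
    by (simp add: inner_V_matrix[OF assms(1,2)] mult.assoc)
qed

text \<open>An eigenvector with nonnegative eigenvalue has no part orthogonal to \<open>1\<close>,
  so it is a multiple of \<open>1\<close>. Two orthonormal vectors cannot both be such multiples,
  and the expansion of \<open>1\<close> supplies one.\<close>

lemma nonneg_eigenvector_unique:
  fixes G Gt :: "real ^ 'n ^ 'n"
  assumes "is_graph G" "is_graph Gt" "\<beta> \<ge> 0" "2 * \<beta> * c > 1"
    and c: "\<And>y. y \<bullet> 1 = 0 \<Longrightarrow> c * (y \<bullet> y) \<le> y \<bullet> ((laplacian Gt - laplacian G) *v y)"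
    and z: "orthonormal_eigenbasis (V_matrix \<beta> G Gt) z \<omega>"
  obtains k d where "{j. \<omega> j \<ge> 0} = {k}" "z k = d *\<^sub>R 1" "d \<noteq> 0"
proof -
  let ?V = "V_matrix \<beta> G Gt"
  have orth: "z i \<bullet> z j = (if i = j then 1 else 0)" and eig: "?V *v z j = \<omega> j *\<^sub>R z j" for i j
    using z unfolding orthonormal_eigenbasis_def by auto
  note V1 = V_matrix_mult_ones[OF assms(1,3), of Gt]
  have const: "\<exists>d. d \<noteq> 0 \<and> z j = d *\<^sub>R 1" if "\<omega> j \<ge> 0" for j
  proof -
    \<comment> \<open>The coefficient of the orthogonal projection onto \<open>1\<close>, whose
      squared norm is the number of agents.\<close>
    define d where "d = (z j \<bullet> 1) / real CARD('n)"
    define y where "y = z j - d *\<^sub>R 1"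
    have y1: "y \<bullet> 1 = 0"
      unfolding y_def d_def by (simp add: inner_diff_left inner_ones sum_subtractf)
    have "y \<bullet> (?V *v y) = y \<bullet> (\<omega> j *\<^sub>R z j - d *\<^sub>R 1)"
      unfolding y_def by (simp add: matrix_vector_mult_diff_distrib matrix_vector_mult_scaleR eig V1)
    also have "\<dots> = \<omega> j * (y \<bullet> z j)" using y1 by (simp add: inner_diff_right)
    also have "z j = y + d *\<^sub>R 1" by (simp add: y_def)
    also have "\<omega> j * (y \<bullet> (y + d *\<^sub>R 1)) = \<omega> j * (y \<bullet> y)" using y1 by (simp add: inner_add_right)
    also have "\<dots> \<ge> 0" using that by simp
    finally have "y = 0"
      using V_matrix_negative[OF assms(1,3,4) c y1] by force
    then have "z j = d *\<^sub>R 1" by (simp add: y_def)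
    moreover have "d \<noteq> 0" using calculation orth[of j j] by auto
    ultimately show ?thesis by blast
  qed
  \<comment> \<open>Otherwise every coefficient in the expansion of \<open>1\<close> would be
    zero.\<close>
  obtain k where k: "z k \<bullet> 1 \<noteq> 0"
  proof -
    have "(\<Sum>j\<in>UNIV. (z j \<bullet> 1) *\<^sub>R z j) = 1"
      by (rule orthonormal_family_expansion) (rule orth)
    then show ?thesis using that by (metis (no_types, lifting) scale_zero_left sum.neutral zero_neq_one)
  qed
  \<comment> \<open>Symmetry of \<open>?V\<close> moves it onto the fixed vector \<open>1\<close>,
    which forces \<open>\<omega> k\<close> to be 1.\<close>
  have "\<omega> k * (z k \<bullet> 1) = 1 \<bullet> (?V *v z k)" by (simp add: eig inner_commute)
  also have "\<dots> = (?V *v 1) \<bullet> z k"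
    using transpose_V_matrix[OF assms(1,2)] by (metis inner_mult_eq_transpose_mult)
  also have "\<dots> = z k \<bullet> 1" by (simp add: V1 inner_commute)
  finally have "\<omega> k \<ge> 0" using k by simp
  moreover have "j = k" if j: "\<omega> j \<ge> 0" for j
  proof (rule ccontr)
    assume "j \<noteq> k"
    obtain d where "d \<noteq> 0" "z j = d *\<^sub>R 1" using const[OF j] by blast
    moreover obtain e where "e \<noteq> 0" "z k = e *\<^sub>R 1" using const[OF \<open>\<omega> k \<ge> 0\<close>] by blast
    ultimately show False using orth[of j k] \<open>j \<noteq> k\<close> by (simp add: inner_ones)
  qed
  ultimately have "{j. \<omega> j \<ge> 0} = {k}" by blast
  moreover obtain d where "d \<noteq> 0" "z k = d *\<^sub>R 1" using const[OF \<open>\<omega> k \<ge> 0\<close>] by blast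
  ultimately show ?thesis by (intro that)
qed

section \<open>Equivalence with disclosing the average\<close>

lemma garbling_disclosure:
  fixes f :: "real ^ 'n \<Rightarrow> 'm"
  assumes f: "\<And>x. f x \<in> space M" and h: "h \<in> M \<rightarrow>\<^sub>M N" and g: "\<And>x. g x = h (f x)"
  shows "garbling M (disclosure M f) N (disclosure N g)"
proof -
  have \<kappa>: "(\<lambda>m. return N (h m)) \<in> M \<rightarrow>\<^sub>M prob_algebra N"
    by (rule measurable_compose[OF h measurable_return_prob_space])
  have "return M (f x) \<bind> (\<lambda>m. return N (h m)) = return N (g x)" for x
    unfolding g by (rule bind_return[OF measurable_prob_algebraD[OF \<kappa>] f])
  then show ?thesis
    unfolding garbling_def disclosure_def using \<kappa> by (intro bexI[of _ "\<lambda>m. return N (h m)"]) auto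
qed

text \<open>The only disclosed statistic is the average times the nonzero factor
  \<open>d * real CARD('n)\<close>, so each message is computed from the other by rescaling.\<close>

lemma phi_star_equivalent_average:
  fixes z :: "'n::finite \<Rightarrow> real ^ 'n"
  assumes k: "{j. \<omega> j \<ge> 0} = {k}" and z: "z k = d *\<^sub>R 1" and d: "d \<noteq> 0"
  shows "informationally_equivalent (phi_star_space \<omega>) (phi_star z \<omega>) borel (disclosure borel average)"
proof -
  have zk: "z k \<bullet> x = d * real CARD('n) * average x" for x
    by (simp add: z average_def inner_vec_def flip: sum_distrib_left)
  have M: "phi_star_space \<omega> = (\<Pi>\<^sub>M j\<in>{k}. borel)"
    unfolding phi_star_space_def k ..
  show ?thesis
    unfolding informationally_equivalent_def phi_star_def
  proof
    show "garbling (phi_star_space \<omega>) (disclosure (phi_star_space \<omega>) (\<lambda>x. \<lambda>j\<in>{j. \<omega> j \<ge> 0}. z j \<bullet> x))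
        borel (disclosure borel average)"
    proof (rule garbling_disclosure)
      show "(\<lambda>m. m k / (d * real CARD('n))) \<in> phi_star_space \<omega> \<rightarrow>\<^sub>M borel"
        unfolding M by measurable
      show "average x = (\<lambda>j\<in>{j. \<omega> j \<ge> 0}. z j \<bullet> x) k / (d * real CARD('n))" for x :: "real ^ 'n"
        unfolding k by (simp add: zk d)
    qed (simp add: phi_star_space_def space_PiM)
    show "garbling borel (disclosure borel average)
        (phi_star_space \<omega>) (disclosure (phi_star_space \<omega>) (\<lambda>x. \<lambda>j\<in>{j. \<omega> j \<ge> 0}. z j \<bullet> x))"
    proof (rule garbling_disclosure)
      show "(\<lambda>r. \<lambda>j\<in>{k}. d * real CARD('n) * r) \<in> borel \<rightarrow>\<^sub>M phi_star_space \<omega>"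
        unfolding M by (rule measurable_restrict) simp
      show "(\<lambda>j\<in>{j. \<omega> j \<ge> 0}. z j \<bullet> x) = (\<lambda>j\<in>{k}. d * real CARD('n) * average x)" for x :: "real ^ 'n"
        unfolding k by (auto simp: fun_eq_iff zk)
    qed simp
  qed
qed

text \<open>The first conjunct justifies calling \<open>phi_star\<close> optimal. Quantifying over
  \<open>z\<close> and \<open>\<omega>\<close> inside the eventuality makes one threshold for
  \<open>\<beta>\<close> serve all eigenbases.\<close>

theorem proposition7:
  fixes G Gt :: "real ^ 'n ^ 'n" and \<mu> \<sigma> :: real
  assumes "is_graph G" and "is_graph Gt" and "\<sigma> > 0"
    and "Gt = complete_graph"
    and "graph_connected (complement_graph G)"
  shows
    "(\<forall>\<beta>\<ge>0. \<forall>z \<omega>. orthonormal_eigenbasis (V_matrix \<beta> G Gt) z \<omega> \<longrightarrow>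
        optimal_signal TYPE('k) \<mu> \<sigma> \<beta> G Gt (phi_star_space \<omega>) (phi_star z \<omega>))
     \<and> (\<forall>\<^sub>F \<beta> in at_top. \<forall>z \<omega>. orthonormal_eigenbasis (V_matrix \<beta> G Gt) z \<omega> \<longrightarrow>
        informationally_equivalent (phi_star_space \<omega>) (phi_star z \<omega>)
          borel (disclosure borel average))"
proof (intro conjI allI impI)
  fix \<beta> z \<omega>
  assume "0 \<le> \<beta>" "orthonormal_eigenbasis (V_matrix \<beta> G Gt) z \<omega>"
  then show "optimal_signal TYPE('k) \<mu> \<sigma> \<beta> G Gt (phi_star_space \<omega>) (phi_star z \<omega>)"
    using assms by (intro optimal_signal_phi_star)
next
  have eq: "laplacian (complement_graph G) = laplacian Gt - laplacian G"
    using laplacian_complement_graph[OF assms(1)] assms(4) by simp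
  obtain c where "c > 0"
    and c: "\<And>y. y \<bullet> 1 = 0 \<Longrightarrow> c * (y \<bullet> y) \<le> y \<bullet> (laplacian (complement_graph G) *v y)"
    using connected_laplacian_coercive[OF is_graph_complement_graph[OF assms(1)] assms(5)] by blast
  show "\<forall>\<^sub>F \<beta> in at_top. \<forall>z \<omega>. orthonormal_eigenbasis (V_matrix \<beta> G Gt) z \<omega> \<longrightarrow>
      informationally_equivalent (phi_star_space \<omega>) (phi_star z \<omega>) borel (disclosure borel average)"
    \<comment> \<open>Beyond this threshold \<open>2 * \<beta> * c > 1\<close>, so coercivity
      outweighs the identity in \<open>V_matrix\<close> on vectors orthogonal to
      \<open>1\<close>.\<close>
    using eventually_gt_at_top[of "1 / (2 * c)"] eventually_ge_at_top[of 0]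
  proof (eventually_elim, intro allI impI)
    fix \<beta> z \<omega>
    assume "\<beta> > 1 / (2 * c)" "\<beta> \<ge> 0" and z: "orthonormal_eigenbasis (V_matrix \<beta> G Gt) z \<omega>"
    then have "2 * \<beta> * c > 1"
      using \<open>c > 0\<close> by (simp add: field_simps)
    then obtain k d where "{j. \<omega> j \<ge> 0} = {k}" "z k = d *\<^sub>R 1" "d \<noteq> 0"
      by (rule nonneg_eigenvector_unique[OF assms(1,2) \<open>\<beta> \<ge> 0\<close> _ c[unfolded eq] z])
    then show "informationally_equivalent (phi_star_space \<omega>) (phi_star z \<omega>) borel (disclosure borel average)"
      by (rule phi_star_equivalent_average)
  qed
qed

end
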